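(* Let $S=(X,\mathbb{A},\mathbb{R})$ be an axiomatic formal system, let $A\subseteq X$ and let $a\in X$. Then $A\vdash_S^P a$ if and only if there is an $S$-consistent set $A'\subseteq A$ such that $A'\vdash_S a$.
   Context: For a positive integer $n$ and a non-empty set $X$, let $\wp^{(n)}(X)=\{A\subseteq X: |A|=n\}$. An inference rule of degree $n$ on $X$ is a relation $R\subseteq \wp^{(n)}(X)\times X$; if $(\{x_1,\dots,x_n\},x)\in R$, then $x$ is an immediate consequence of $\{x_1,\dots,x_n\}$ by $R$. For a family $\mathbb{R}$ of inference rules, $x$ is an immediate consequence of $\{x_1,\dots,x_n\}$ if it is so by some $R\in\mathbb{R}$. An axiomatic formal system is a triple $S=(X,\mathbb{A},\mathbb{R})$ where $X$ is a non-empty set (of formulas), $\mathbb{A}\subseteq X$ (the axioms), and $\mathbb{R}$ is a finite family of inference rules on $X$ (each of some positive degree). For $A\subseteq X$, an $S$-deduction from $A$ is a finite (non-empty) sequence $a_1,\dots,a_n$ of elements of $X$ such that for each $1\le i\le n$: $a_i\in A$, or $a_i\in\mathbb{A}$, or $a_i$ is an immediate consequence of a set of formulas preceding it in the sequence. Write $A\vdash_S a$ if there is an $S$-deduction $a_1,\dots,a_n$ from $A$ with $a_n=a$, and $Cn_S(A)=\{a\in X: A\vdash_S a\}$. The set $A$ is $S$-consistent if $Cn_S(A)\neq X$, and $S$-inconsistent otherwise. Standing assumption: in every axiomatic formal system, $\emptyset$ is $S$-consistent. A paradeduction in $S$ from $A\subseteq X$ is a finite (non-empty) sequence of pairs $(A_1,a_1),\dots,(A_n,a_n)$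 with $A_i\subseteq X$ and $a_i\in X$ such that: (1) $A_i$ is $S$-consistent for all $1\le i\le n$; (2) for each $1\le i\le n$ one of the following holds: (a) $a_i\in A$ and $A_i=\{a_i\}$; (b) $a_i\in\mathbb{A}$ and $A_i=\emptyset$; (c) $a_i$ is an immediate consequence of a set of preceding formulas $\{a_{i_1},\dots,a_{i_k}\}$ (with $i_1,\dots,i_k<i$) and $A_i=\bigcup_{j=1}^k A_{i_j}$. Write $A\vdash_S^P a$ if there is a paradeduction $(A_1,a_1),\dots,(A_n,a_n)$ in $S$ from $A$ with $a_n=a$. *)

theory Defs
  imports "HOL-Library.Ramsey"
begin

definition is_rule_of_degree :: "'a set \<Rightarrow> nat \<Rightarrow> ('a set \<times> 'a) set \<Rightarrow> bool" where
  "is_rule_of_degree X n R \<longleftrightarrow> R \<subseteq> nsets X n \<times> X"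

record 'a formal_system =
  formulas :: "'a set"
  axioms :: "'a set"
  rules :: "('a set \<times> 'a) set set"

text \<open>The standing assumption that the empty set is consistent is not part of this
  predicate; theorems state it explicitly.\<close>

definition axiomatic_formal_system :: "'a formal_system \<Rightarrow> bool" where
  "axiomatic_formal_system S \<longleftrightarrow>
     formulas S \<noteq> {} \<and> axioms S \<subseteq> formulas S \<and> finite (rules S) \<and>
     (\<forall>R\<in>rules S. \<exists>n>0. is_rule_of_degree (formulas S) n R)"

definition immediate_consequence :: "'a formal_system \<Rightarrow> 'a set \<Rightarrow> 'a \<Rightarrow> bool" where
  "immediate_consequence S B x \<longleftrightarrow> (\<exists>R\<in>rules S. (B, x) \<in> R)"

definition deduction :: "'a formal_system \<Rightarrow> 'a set \<Rightarrow> 'a list \<Rightarrow> bool" where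
  "deduction S A as \<longleftrightarrow>
     as \<noteq> [] \<and> set as \<subseteq> formulas S \<and>
     (\<forall>i<length as.
        as ! i \<in> A \<or>
        as ! i \<in> axioms S \<or>
        (\<exists>B \<subseteq> {as ! j | j. j < i}. immediate_consequence S B (as ! i)))"

definition deducible :: "'a formal_system \<Rightarrow> 'a set \<Rightarrow> 'a \<Rightarrow> bool" where
  "deducible S A a \<longleftrightarrow> (\<exists>as. deduction S A as \<and> last as = a)"

definition Cn :: "'a formal_system \<Rightarrow> 'a set \<Rightarrow> 'a set" where
  "Cn S A = {a \<in> formulas S. deducible S A a}"

definition consistent :: "'a formal_system \<Rightarrow> 'a set \<Rightarrow> bool" where
  "consistent S A \<longleftrightarrow> Cn S A \<noteq> formulas S"

text \<open>In the third clause, \<open>J\<close> is the set of positions \<open>i\<^sub>1, \<dots>, i\<^sub>k\<close> at which the premises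
  are taken. The same formula may occur at several positions with different first components,
  so the union is over the chosen positions, not over all occurrences of the premises.\<close>

definition paradeduction :: "'a formal_system \<Rightarrow> 'a set \<Rightarrow> ('a set \<times> 'a) list \<Rightarrow> bool" where
  "paradeduction S A ps \<longleftrightarrow>
     ps \<noteq> [] \<and>
     (\<forall>(B, b) \<in> set ps. B \<subseteq> formulas S \<and> b \<in> formulas S) \<and>
     (\<forall>i<length ps. consistent S (fst (ps ! i))) \<and>
     (\<forall>i<length ps.
        (snd (ps ! i) \<in> A \<and> fst (ps ! i) = {snd (ps ! i)}) \<or>
        (snd (ps ! i) \<in> axioms S \<and> fst (ps ! i) = {}) \<or>
        (\<exists>J \<subseteq> {..<i}.
           immediate_consequence S ((\<lambda>j. snd (ps ! j)) ` J) (snd (ps ! i)) \<and>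
           fst (ps ! i) = (\<Union>j\<in>J. fst (ps ! j))))"

definition paradeducible :: "'a formal_system \<Rightarrow> 'a set \<Rightarrow> 'a \<Rightarrow> bool" where
  "paradeducible S A a \<longleftrightarrow> (\<exists>ps. paradeduction S A ps \<and> snd (last ps) = a)"

end

theory Submission
  imports Defs
begin

text \<open>
  A paradeduction is a deduction whose entries carry the set of hypotheses they rest on.

  If \<open>(A\<^sub>n, a\<^sub>n)\<close> is the last entry of a paradeduction from \<open>A\<close>, then \<open>A' = A\<^sub>n\<close> is the required
  set: it is consistent by definition, and it is contained in \<open>A\<close> because hypotheses enter only
  through members of \<open>A\<close>. To see that \<open>A\<^sub>n\<close> yields \<open>a\<^sub>n\<close>, keep exactly the entries whose hypothesis
  set is contained in \<open>A\<^sub>n\<close>. The premises of a kept entry are kept as well, since their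
  hypothesis sets are contained in that of the entry; so what remains is a deduction from \<open>A\<^sub>n\<close>
  (\<open>deduction_of_paradeduction\<close>).

  Conversely, a deduction from a consistent \<open>A'\<close> becomes a paradeduction once every position is
  labelled with the hypotheses accumulated along a chosen justification (\<open>support\<close>). All
  labels are subsets of \<open>A'\<close>, and subsets of consistent sets are consistent
  (\<open>consistent_antimono\<close>).
\<close>

section \<open>Deductions and consistency\<close>

lemma deduction_iff_take:
  "deduction S A as \<longleftrightarrow>
     as \<noteq> [] \<and> set as \<subseteq> formulas S \<and>
     (\<forall>i<length as. as ! i \<in> A \<or> as ! i \<in> axioms S \<or>
        (\<exists>B \<subseteq> set (take i as). immediate_consequence S B (as ! i)))"
proof -
  have "{as ! j | j. j < i} = set (take i as)" if "i < length as" for i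
    using that nth_image[of i as] by force
  then show ?thesis
    unfolding deduction_def by (simp cong: imp_cong)
qed

lemma deduction_mono:
  assumes "deduction S A as" "A \<subseteq> B"
  shows "deduction S B as"
  using assms unfolding deduction_def by blast

lemma consistent_antimono:
  assumes "consistent S B" "A \<subseteq> B"
  shows "consistent S A"
  using assms deduction_mono unfolding consistent_def Cn_def deducible_def by blast

section \<open>From paradeductions to deductions\<close>

lemma nth_filter_take:
  assumes "k < length (filter P xs)"
  obtains i where "i < length xs" "filter P xs ! k = xs ! i" "P (xs ! i)"
    "take k (filter P xs) = filter P (take i xs)"
  using assms
proof (induction xs arbitrary: thesis rule: rev_induct)
  case Nil
  then show ?case by simp
next
  case (snoc x xs)
  show ?case
  proof (cases "k < length (filter P xs)")
    case True
    then obtain i where "i < length xs" "filter P xs ! k = xs ! i" "P (xs ! i)"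
      "take k (filter P xs) = filter P (take i xs)"
      using snoc.IH by blast
    then show ?thesis
      using True by (intro snoc.prems(1)[of i]) (auto simp: nth_append)
  next
    case False
    then have "P x" "k = length (filter P xs)"
      using snoc.prems(2) by (auto split: if_splits)
    then show ?thesis
      by (intro snoc.prems(1)[of "length xs"]) auto
  qed
qed

lemma paradeduction_entry_cases:
  assumes "paradeduction S A ps" "i < length ps"
  obtains (hypothesis) "snd (ps ! i) \<in> A" "fst (ps ! i) = {snd (ps ! i)}"
    | (axiom) "snd (ps ! i) \<in> axioms S" "fst (ps ! i) = {}"
    | (rule) J where "J \<subseteq> {..<i}"
        "immediate_consequence S ((\<lambda>j. snd (ps ! j)) ` J) (snd (ps ! i))"
        "fst (ps ! i) = (\<Union>j\<in>J. fst (ps ! j))"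
proof -
  have "(snd (ps ! i) \<in> A \<and> fst (ps ! i) = {snd (ps ! i)}) \<or>
        (snd (ps ! i) \<in> axioms S \<and> fst (ps ! i) = {}) \<or>
        (\<exists>J \<subseteq> {..<i}.
           immediate_consequence S ((\<lambda>j. snd (ps ! j)) ` J) (snd (ps ! i)) \<and>
           fst (ps ! i) = (\<Union>j\<in>J. fst (ps ! j)))"
    using assms by (simp add: paradeduction_def)
  then show thesis
    by (elim disjE exE conjE) (fact that)+
qed

lemma paradeduction_hypotheses_subset:
  assumes "paradeduction S A ps" "i < length ps"
  shows "fst (ps ! i) \<subseteq> A"
  using assms(2)
proof (induction i rule: less_induct)
  case (less i)
  then have IH: "fst (ps ! j) \<subseteq> A" if "j < i" for j
    using that by simp
  from assms(1) less.prems show ?case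
  proof (cases rule: paradeduction_entry_cases)
    case (rule J)
    then have "fst (ps ! j) \<subseteq> A" if "j \<in> J" for j
      using IH that by blast
    then show ?thesis
      using rule(3) by (simp add: UN_subset_iff)
  qed simp_all
qed

text \<open>Discarding the entries that rest on hypotheses outside \<open>H\<close> never discards a premise of an
  entry that is kept, because hypothesis sets only grow along inferences.\<close>

lemma deduction_of_paradeduction:
  assumes para: "paradeduction S A ps"
    and nonempty: "filter (\<lambda>p. fst p \<subseteq> H) ps \<noteq> []"
  shows "deduction S H (map snd (filter (\<lambda>p. fst p \<subseteq> H) ps))"
proof -
  let ?P = "\<lambda>p :: 'a set \<times> 'a. fst p \<subseteq> H"
  let ?as = "map snd (filter ?P ps)"
  have "?as ! k \<in> H \<or> ?as ! k \<in> axioms S \<or>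
        (\<exists>B \<subseteq> set (take k ?as). immediate_consequence S B (?as ! k))"
    if k: "k < length ?as" for k
  proof -
    obtain i where i: "i < length ps" "filter ?P ps ! k = ps ! i" "?P (ps ! i)"
      "take k (filter ?P ps) = filter ?P (take i ps)"
      using k nth_filter_take[of k ?P ps] by auto
    have entry: "?as ! k = snd (ps ! i)"
      using i(2) k by simp
    from para i(1) show ?thesis
    proof (cases rule: paradeduction_entry_cases)
      case hypothesis
      then show ?thesis using i(3) entry by simp
    next
      case axiom
      then show ?thesis using entry by simp
    next
      case (rule J)
      have "snd (ps ! j) \<in> set (take k ?as)" if "j \<in> J" for j
      proof -
        have "j < i" using rule(1) that by auto
        then have "ps ! j \<in> set (take i ps)"
          using i(1) by (auto simp: in_set_conv_nth)
        moreover have "?P (ps ! j)"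
          using that rule(3) i(3) by auto
        ultimately show ?thesis
          using i(4) by (simp add: take_map)
      qed
      then have "(\<lambda>j. snd (ps ! j)) ` J \<subseteq> set (take k ?as)"
        by blast
      then show ?thesis
        using rule(2) entry by auto
    qed
  qed
  moreover have "set ?as \<subseteq> formulas S"
    using para unfolding paradeduction_def by auto
  ultimately show ?thesis
    using nonempty unfolding deduction_iff_take by blast
qed

lemma paradeducible_imp_deducible:
  assumes "paradeducible S A a"
  shows "\<exists>A' \<subseteq> A. consistent S A' \<and> deducible S A' a"
proof -
  obtain ps where ps: "paradeduction S A ps" "snd (last ps) = a"
    using assms unfolding paradeducible_def by blast
  then have ne: "ps \<noteq> []"
    unfolding paradeduction_def by blast
  let ?H = "fst (last ps)"
  let ?qs = "filter (\<lambda>p. fst p \<subseteq> ?H) ps"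
  have last_nth: "last ps = ps ! (length ps - 1)" "length ps - 1 < length ps"
    using ne by (auto simp: last_conv_nth)
  have split: "ps = butlast ps @ [last ps]"
    using ne by simp
  have qs: "?qs = filter (\<lambda>p. fst p \<subseteq> ?H) (butlast ps) @ [last ps]"
    by (subst (2) split) (simp del: append_butlast_last_id)
  have "deduction S ?H (map snd ?qs)"
    by (rule deduction_of_paradeduction[OF ps(1)]) (simp add: qs)
  moreover have "last (map snd ?qs) = a"
    using ps(2) by (simp add: qs)
  ultimately have "deducible S ?H a"
    unfolding deducible_def by blast
  moreover have "?H \<subseteq> A"
    using paradeduction_hypotheses_subset[OF ps(1) last_nth(2)] last_nth(1) by simp
  moreover have "consistent S ?H"
    using ps(1) last_nth unfolding paradeduction_def by simp
  ultimately show ?thesis by (intro exI[of _ ?H] conjI)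
qed

section \<open>From deductions to paradeductions\<close>

text \<open>The hypotheses from \<open>H\<close> on which position \<open>i\<close> of a sequence \<open>f\<close> rests, when \<open>J j\<close> is the set
  of positions that supplies the premises at position \<open>j\<close>. For an axiom outside \<open>H\<close>,
  \<open>J j = {}\<close> gives the empty support. The intersection with \<open>{..<i}\<close> makes the recursion well-founded for arbitrary \<open>J\<close>.\<close>

function support :: "'a set \<Rightarrow> (nat \<Rightarrow> 'a) \<Rightarrow> (nat \<Rightarrow> nat set) \<Rightarrow> nat \<Rightarrow> 'a set" where
  "support H f J i =
     (if f i \<in> H then {f i} else (\<Union>j \<in> J i \<inter> {..<i}. support H f J j))"
  by pat_completeness auto
termination
  by (relation "measure (\<lambda>(H, f, J, i). i)") auto

declare support.simps [simp del]

lemma support_subset: "support H f J i \<subseteq> H"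
proof (induction i rule: less_induct)
  case (less i)
  then show ?case
    by (subst support.simps) auto
qed

lemma deducible_imp_paradeducible:
  assumes "A' \<subseteq> A" "A' \<subseteq> formulas S" "consistent S A'" "deducible S A' a"
  shows "paradeducible S A a"
proof -
  obtain as where as: "deduction S A' as" "last as = a"
    using assms(4) unfolding deducible_def by blast
  have ne: "as \<noteq> []" and formulas: "set as \<subseteq> formulas S"
    using as(1) unfolding deduction_def by auto
  \<comment> \<open>The label of a position depends on which occurrences of its premises are used, so one choice
    of positions has to be fixed for the whole deduction before labels can be computed.\<close>
  let ?justified = "\<lambda>i K. as ! i \<in> A' \<or> (as ! i \<in> axioms S \<and> K = {}) \<or>
    (K \<subseteq> {..<i} \<and> immediate_consequence S ((\<lambda>j. as ! j) ` K) (as ! i))"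
  have "\<exists>K. ?justified i K" if i: "i < length as" for i
  proof -
    have "as ! i \<in> A' \<or> as ! i \<in> axioms S \<or>
        (\<exists>B \<subseteq> {as ! j | j. j < i}. immediate_consequence S B (as ! i))"
      using as(1) i by (simp add: deduction_def)
    then consider (given) "as ! i \<in> A' \<or> as ! i \<in> axioms S"
      | (rule) B where "B \<subseteq> {as ! j | j. j < i}" "immediate_consequence S B (as ! i)"
      by (elim disjE exE conjE) blast+
    then show ?thesis
    proof cases
      case given
      then show ?thesis by (intro exI[of _ "{}"]) blast
    next
      case rule
      let ?K = "{j. j < i \<and> as ! j \<in> B}"
      have "(\<lambda>j. as ! j) ` ?K = B"
        using rule(1) by auto
      moreover have "?K \<subseteq> {..<i}"
        by auto
      ultimately show ?thesis
        using rule(2) by (intro exI[of _ ?K]) simp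
    qed
  qed
  then have "\<exists>J. \<forall>i\<in>{..<length as}. ?justified i (J i)"
    by (intro bchoice) simp
  then obtain J where "\<forall>i\<in>{..<length as}. ?justified i (J i)" ..
  then have J: "?justified i (J i)" if "i < length as" for i
    using that by simp
  let ?U = "support A' (\<lambda>i. as ! i) J"
  define ps where "ps = map (\<lambda>i. (?U i, as ! i)) [0..<length as]"
  have len: "length ps = length as"
    by (simp add: ps_def)
  have nth: "ps ! i = (?U i, as ! i)" if "i < length as" for i
    using that by (simp add: ps_def)
  have "(snd (ps ! i) \<in> A \<and> fst (ps ! i) = {snd (ps ! i)}) \<or>
        (snd (ps ! i) \<in> axioms S \<and> fst (ps ! i) = {}) \<or>
        (\<exists>K \<subseteq> {..<i}. immediate_consequence S ((\<lambda>j. snd (ps ! j)) ` K) (snd (ps ! i)) \<and>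
           fst (ps ! i) = (\<Union>j\<in>K. fst (ps ! j)))"
    if i: "i < length ps" for i
  proof (cases "as ! i \<in> A'")
    case True
    then have "?U i = {as ! i}"
      by (subst support.simps) simp
    then show ?thesis
      using True assms(1) i len nth[of i] by (intro disjI1) auto
  next
    case False
    then have U: "?U i = (\<Union>j \<in> J i \<inter> {..<i}. ?U j)"
      by (subst support.simps) simp
    consider (axiom) "as ! i \<in> axioms S" "J i = {}"
      | (rule) "J i \<subseteq> {..<i}" "immediate_consequence S ((\<lambda>j. as ! j) ` J i) (as ! i)"
      using J[OF i[unfolded len]] False by blast
    then show ?thesis
    proof cases
      case axiom
      then show ?thesis
        using U i len nth[of i] by simp
    next
      case rule
      have before: "ps ! j = (?U j, as ! j)" if "j \<in> J i" for j
      proof -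
        have "j < i" using rule(1) that by auto
        then show ?thesis using i len nth[of j] by simp
      qed
      have "J i \<inter> {..<i} = J i"
        using rule(1) by blast
      then have "fst (ps ! i) = (\<Union>j\<in>J i. fst (ps ! j))"
        using U before i len nth[of i] by simp
      moreover have "(\<lambda>j. snd (ps ! j)) ` J i = (\<lambda>j. as ! j) ` J i"
        using before by simp
      ultimately show ?thesis
        using rule i len nth[of i] by (intro disjI2 exI[of _ "J i"]) simp
    qed
  qed
  moreover have "\<forall>(B, b) \<in> set ps. B \<subseteq> formulas S \<and> b \<in> formulas S"
    using formulas assms(2) support_subset[of A' "\<lambda>i. as ! i" J]
    unfolding ps_def by (auto dest!: nth_mem)
  moreover have "consistent S (fst (ps ! i))" if "i < length ps" for i
    using that len nth consistent_antimono[OF assms(3) support_subset] by simp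
  moreover have "ps \<noteq> []"
    using ne by (simp add: ps_def)
  ultimately have "paradeduction S A ps"
    unfolding paradeduction_def by blast
  moreover have "snd (last ps) = a"
    using ne as(2) len nth[of "length as - 1"] \<open>ps \<noteq> []\<close> by (simp add: last_conv_nth)
  ultimately show ?thesis
    unfolding paradeducible_def by blast
qed

theorem proposition4p2:
  fixes S :: "'a formal_system" and A :: "'a set" and a :: 'a
  assumes "axiomatic_formal_system S"
    and "consistent S {}"
    and "A \<subseteq> formulas S"
    and "a \<in> formulas S"
  shows "paradeducible S A a \<longleftrightarrow> (\<exists>A' \<subseteq> A. consistent S A' \<and> deducible S A' a)"
  using paradeducible_imp_deducible deducible_imp_paradeducible assms(3)
  by (meson subset_trans)

end
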